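(* Let $0<q<1$ be fixed. Suppose $\{h_n\}_{n\ge0}$ is a doubly positive sequence, let $$h(a;x)=\sum_{n=0}^{\infty}\frac{h_nx^n}{(a;q)_n}$$ with radius of convergence $R_h$ in $x$, and let $$\Delta_h(\alpha,\beta;x)=h(q^{\mu+\alpha};x)h(q^{\mu+\beta};x)-h(q^{\mu};x)h(q^{\mu+\alpha+\beta};x).$$ Then for all $\mu,\beta>0$, $\alpha\in\{1,2,3,\dots\}$ and $0\le x<R_h$ the following estimates hold: $$\frac{\Gamma_q(\mu+\alpha)\Gamma_q(\mu+\beta)}{\Gamma_q(\mu)\Gamma_q(\mu+\alpha+\beta)}<\frac{h(q^{\mu+\alpha};x)h(q^{\mu+\beta};x)}{h(q^{\mu};x)h(q^{\mu+\alpha+\beta};x)}\le1 \qquad(\mathrm{A})$$ and $$\left[\frac{\Gamma_q(\mu+\alpha)\Gamma_q(\mu+\beta)}{\Gamma_q(\mu)\Gamma_q(\mu+\alpha+\beta)}-1\right]h(q^{\mu};x)h(q^{\mu+\alpha+\beta};x)<\Delta_h(\alpha,\beta;x)\le\frac{-h_0h_1xq^{\mu}(1-q^{\alpha})(1-q^{\beta})}{(1-q^{\mu})(1-q^{\mu+\alpha+\beta})(1-q^{\mu+\alpha})(1-q^{\mu+\beta})}, \qquad(\mathrm{B})$$ with equality only at $x=0$. The upper bounds in both (A) and (B) remain valid if $\{h_n\}_{n\ge0}$ is any non-negative sequence and $\alpha$ is any positive number.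
   Context: For $0<q<1$: $(a;q)_0=1$, $(a;q)_n=\prod_{k=0}^{n-1}(1-aq^k)$ for $n\ge1$, $(a;q)_\infty=\lim_{n\to\infty}(a;q)_n$, and the $q$-gamma function is $\Gamma_q(z)=(1-q)^{1-z}\dfrac{(q;q)_\infty}{(q^z;q)_\infty}$. The radius $R_h$ is the same for all $a\in(0,1)$. A sequence $\{h_n\}_{n\ge0}$ of nonnegative reals is doubly positive if it is nontrivial (not identically zero), is log-concave ($h_k^2\ge h_{k-1}h_{k+1}$ for all $k\ge1$), and has no internal zeros ($h_N=0$ implies that either $h_{N+i}=0$ for all $i\ge0$, or $h_{N-i}=0$ for $i=0,\dots,N$).
   Formalization: The upper bound in (B) gets an extra numerator factor 1-q^{2μ+α+β} (false without it); equality in the upper bounds holds iff x=0 or h_n=0 for all n≥1; the strict lower bounds and the equality case of (A) exclude x=0 with h_0=0, where the ratio is 0/0. *)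

theory Defs
  imports "HOL-Analysis.Analysis"
begin

definition qpoch :: "real \<Rightarrow> real \<Rightarrow> nat \<Rightarrow> real" where
  "qpoch a q n = (\<Prod>k<n. 1 - a * q ^ k)"

definition qpoch_inf :: "real \<Rightarrow> real \<Rightarrow> real" where
  "qpoch_inf a q = lim (\<lambda>n. qpoch a q n)"

definition q_Gamma :: "real \<Rightarrow> real \<Rightarrow> real" where
  "q_Gamma q z = (1 - q) powr (1 - z) * qpoch_inf q q / qpoch_inf (q powr z) q"

definition doubly_positive :: "(nat \<Rightarrow> real) \<Rightarrow> bool" where
  "doubly_positive h \<longleftrightarrow>
     (\<forall>n. 0 \<le> h n) \<and>
     (\<exists>n. h n \<noteq> 0) \<and>
     (\<forall>k\<ge>1. (h k)\<^sup>2 \<ge> h (k - 1) * h (k + 1)) \<and>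
     (\<forall>N. h N = 0 \<longrightarrow> (\<forall>i. h (N + i) = 0) \<or> (\<forall>i\<le>N. h (N - i) = 0))"

definition q_series :: "real \<Rightarrow> (nat \<Rightarrow> real) \<Rightarrow> real \<Rightarrow> real \<Rightarrow> real" where
  "q_series q h a x = (\<Sum>n. h n * x ^ n / qpoch a q n)"

definition q_radius :: "real \<Rightarrow> (nat \<Rightarrow> real) \<Rightarrow> real \<Rightarrow> ereal" where
  "q_radius q h a = conv_radius (\<lambda>n. h n / qpoch a q n)"

definition q_Delta :: "real \<Rightarrow> (nat \<Rightarrow> real) \<Rightarrow> real \<Rightarrow> real \<Rightarrow> real \<Rightarrow> real \<Rightarrow> real" where
  "q_Delta q h \<mu> \<alpha> \<beta> x =
     q_series q h (q powr (\<mu> + \<alpha>)) x * q_series q h (q powr (\<mu> + \<beta>)) x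
   - q_series q h (q powr \<mu>) x * q_series q h (q powr (\<mu> + \<alpha> + \<beta>)) x"

lemma q_powr_less_1: "0 < q \<Longrightarrow> q < 1 \<Longrightarrow> 0 < z \<Longrightarrow> q powr z < (1::real)"
  using powr_less_mono2[of z q 1] by simp

text \<open>The left-hand side is the coefficient of \<open>x\<close> in the power series of
  \<open>q_Delta q h \<mu> \<alpha> \<beta>\<close>, divided by \<open>h 0 * h 1\<close>.\<close>

lemma q_Delta_linear_coeff:
  assumes "0 < q" "q < 1" "0 < \<mu>" "0 < \<alpha>" "0 < \<beta>"
  shows "1 / qpoch (q powr (\<mu> + \<alpha>)) q 1 + 1 / qpoch (q powr (\<mu> + \<beta>)) q 1
       - 1 / qpoch (q powr \<mu>) q 1 - 1 / qpoch (q powr (\<mu> + \<alpha> + \<beta>)) q 1 =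
    - (q powr \<mu> * (1 - q powr \<alpha>) * (1 - q powr \<beta>) * (1 - q powr (2 * \<mu> + \<alpha> + \<beta>))) /
       ((1 - q powr \<mu>) * (1 - q powr (\<mu> + \<alpha> + \<beta>)) *
        (1 - q powr (\<mu> + \<alpha>)) * (1 - q powr (\<mu> + \<beta>)))"
proof -
  define a s t where "a = q powr \<mu>" and "s = q powr \<alpha>" and "t = q powr \<beta>"
  have p: "q powr (\<mu> + \<alpha>) = a * s" "q powr (\<mu> + \<beta>) = a * t" "q powr (\<mu> + \<alpha> + \<beta>) = a * s * t"
    "q powr (2 * \<mu> + \<alpha> + \<beta>) = a * a * s * t" "q powr \<mu> = a" "q powr \<alpha> = s" "q powr \<beta> = t"
    unfolding a_def s_def t_def powr_add mult_2 by (rule refl)+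
  have "q powr z \<noteq> 1" if "0 < z" for z
    using q_powr_less_1[of q z] assms that by simp
  from this[of \<mu>] this[of "\<mu> + \<alpha>"] this[of "\<mu> + \<beta>"] this[of "\<mu> + \<alpha> + \<beta>"]
  have n: "1 - a * s \<noteq> 0" "1 - a * t \<noteq> 0" "1 - a \<noteq> 0" "1 - a * s * t \<noteq> 0"
    using assms by (auto simp: p)
  have frac: "1 / A + 1 / B - 1 / C - 1 / D =
      (B * C * D + A * C * D - A * B * D - A * B * C) / (C * D * A * B)"
    if "A \<noteq> 0" "B \<noteq> 0" "C \<noteq> 0" "D \<noteq> 0" for A B C D :: real
  proof -
    have "1 / A = B * C * D / (C * D * A * B)" "1 / B = A * C * D / (C * D * A * B)"
      "1 / C = A * B * D / (C * D * A * B)" "1 / D = A * B * C / (C * D * A * B)"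
      using that by simp_all
    thus ?thesis by (simp only: add_divide_distrib diff_divide_distrib)
  qed
  have num: "(1 - a * t) * (1 - a) * (1 - a * s * t) + (1 - a * s) * (1 - a) * (1 - a * s * t)
      - (1 - a * s) * (1 - a * t) * (1 - a * s * t) - (1 - a * s) * (1 - a * t) * (1 - a)
      = - (a * (1 - s) * (1 - t) * (1 - a * a * s * t))"
    by (simp add: algebra_simps)
  have "qpoch c q 1 = 1 - c" for c by (simp add: qpoch_def)
  thus ?thesis by (simp only: p frac[OF n] num)
qed

text \<open>The factor \<open>1 - q powr (2 * \<mu> + \<alpha> + \<beta>)\<close>, which is missing from the upper bound for
  \<open>q_Delta\<close> as printed in the literature, cannot be dropped: without it the bound fails already
  for \<open>h = (1, 1, 0, 0, ...)\<close> and \<open>\<mu> = \<alpha> = \<beta> = 1\<close>, \<open>q = 1/2\<close>, \<open>x = 1/100\<close>.\<close>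

lemma q_Delta_upper_factor_needed:
  defines "h \<equiv> (\<lambda>n::nat. if n \<le> 1 then 1 else 0 :: real)"
  shows "doubly_positive h"
    and "ereal (1/100) < q_radius (1/2) h ((1/2) powr 1)"
    and "q_Delta (1/2) h 1 1 1 (1/100) >
      - (h 0 * h 1 * (1/100) * (1/2) powr 1 * (1 - (1/2) powr 1) * (1 - (1/2) powr 1)) /
        ((1 - (1/2) powr 1) * (1 - (1/2) powr (1 + 1 + 1)) *
         (1 - (1/2) powr (1 + 1)) * (1 - (1/2) powr (1 + 1)))"
proof -
  show "doubly_positive h"
    by (auto simp: doubly_positive_def h_def intro: exI[of _ 0])
  have "q_radius (1/2) h ((1/2) powr 1) = conv_radius (\<lambda>n. 0 :: real)"
    unfolding q_radius_def
    by (intro conv_radius_cong eventually_sequentiallyI[of 2]) (auto simp: h_def)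
  thus "ereal (1/100) < q_radius (1/2) h ((1/2) powr 1)" by simp
  have s: "q_series (1/2) h a x = 1 + x / (1 - a)" for a x
    unfolding q_series_def
    by (subst suminf_finite[of "{..<2}"]) (auto simp: h_def qpoch_def numeral_2_eq_2)
  have p: "(1/2::real) powr (1 + 1) = 1/4" "(1/2::real) powr (1 + 1 + 1) = 1/8"
    by (simp_all only: powr_add, simp_all)
  show "q_Delta (1/2) h 1 1 1 (1/100) >
      - (h 0 * h 1 * (1/100) * (1/2) powr 1 * (1 - (1/2) powr 1) * (1 - (1/2) powr 1)) /
        ((1 - (1/2) powr 1) * (1 - (1/2) powr (1 + 1 + 1)) *
         (1 - (1/2) powr (1 + 1)) * (1 - (1/2) powr (1 + 1)))"
    unfolding q_Delta_def s p by (simp add: h_def field_simps)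
qed

lemma qpoch_bounds:
  assumes "0 < q" "q < 1" "0 < a" "a < 1"
  shows "convergent (qpoch a q)"
    and "\<exists>L>0. \<forall>n. L \<le> qpoch a q n \<and> qpoch a q n \<le> 1"
proof -
  have f: "0 < 1 - a * q ^ k" "1 - a * q ^ k \<le> 1" for k
  proof -
    have "a * q ^ k \<le> a * 1" using assms by (intro mult_left_mono power_le_one) auto
    thus "0 < 1 - a * q ^ k" using assms(4) by linarith
    show "1 - a * q ^ k \<le> 1" using assms by simp
  qed
  have "summable (\<lambda>k. norm ((1 - a * q ^ k) - 1))"
    using assms by (simp add: abs_mult summable_mult)
  hence "abs_convergent_prod (\<lambda>k. 1 - a * q ^ k)"
    by (rule summable_imp_abs_convergent_prod)
  hence "convergent_prod (\<lambda>k. 1 - a * q ^ k)"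
    by (rule abs_convergent_prod_imp_convergent_prod)
  then obtain L where L: "(\<lambda>n. \<Prod>k\<le>n. 1 - a * q ^ k) \<longlonglongrightarrow> L" "L \<noteq> 0"
    using convergent_prod_iff_nz_lim[of "\<lambda>k. 1 - a * q ^ k"] f(1) by (metis less_irrefl)
  have "(\<lambda>n. qpoch a q (Suc n)) \<longlonglongrightarrow> L"
    using L(1) by (simp only: qpoch_def lessThan_Suc_atMost)
  hence lim: "qpoch a q \<longlonglongrightarrow> L" by (simp only: filterlim_sequentially_Suc)
  thus "convergent (qpoch a q)" by (rule convergentI)
  have pos: "0 < qpoch a q n" for n unfolding qpoch_def by (intro prod_pos) (use f in auto)
  have dec: "decseq (qpoch a q)"
  proof (rule decseq_SucI)
    fix n show "qpoch a q (Suc n) \<le> qpoch a q n"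
      using mult_left_mono[OF f(2)[of n] less_imp_le[OF pos[of n]]] by (simp add: qpoch_def)
  qed
  have "0 \<le> L" by (rule LIMSEQ_le_const[OF lim]) (auto intro: less_imp_le pos)
  moreover have "L \<le> qpoch a q n" for n using decseq_ge[OF dec lim] .
  moreover have "qpoch a q n \<le> 1" for n
    using decseqD[OF dec, of 0 n] by (simp add: qpoch_def)
  ultimately show "\<exists>L>0. \<forall>n. L \<le> qpoch a q n \<and> qpoch a q n \<le> 1"
    using L(2) by (intro exI[of _ L]) auto
qed

lemma q_radius_indep:
  assumes "0 < q" "q < 1" "0 < a" "a < 1"
  shows "q_radius q h a = conv_radius h"
proof -
  obtain L where L: "L > 0" "\<And>n. L \<le> qpoch a q n" "\<And>n. qpoch a q n \<le> 1"
    using qpoch_bounds(2)[OF assms] by blast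
  have s: "summable (\<lambda>n. norm (h n / qpoch a q n * r ^ n)) \<longleftrightarrow> summable (\<lambda>n. norm (h n * r ^ n))"
    for r
  proof
    assume *: "summable (\<lambda>n. norm (h n / qpoch a q n * r ^ n))"
    have "\<bar>h n * r ^ n\<bar> \<le> \<bar>h n / qpoch a q n * r ^ n\<bar>" for n
    proof -
      have "0 < qpoch a q n" using L(1) L(2)[of n] by linarith
      hence "\<bar>h n * r ^ n\<bar> \<le> \<bar>h n * r ^ n\<bar> / qpoch a q n"
        using L(3)[of n] \<open>0 < qpoch a q n\<close>
        by (simp add: pos_le_divide_eq mult_left_le)
      thus ?thesis using \<open>0 < qpoch a q n\<close> by (simp add: abs_mult)
    qed
    thus "summable (\<lambda>n. norm (h n * r ^ n))"
      by (intro summable_comparison_test[OF _ *] exI allI impI) (simp only: real_norm_def abs_abs)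
  next
    assume "summable (\<lambda>n. norm (h n * r ^ n))"
    hence *: "summable (\<lambda>n. norm (h n * r ^ n) / L)" by (rule summable_divide)
    have "\<bar>h n / qpoch a q n * r ^ n\<bar> \<le> \<bar>h n * r ^ n\<bar> / L" for n
    proof -
      have "0 < qpoch a q n" using L(1) L(2)[of n] by linarith
      moreover have "\<bar>h n * r ^ n\<bar> / qpoch a q n \<le> \<bar>h n * r ^ n\<bar> / L"
        using L(1) L(2)[of n] calculation by (intro divide_left_mono mult_pos_pos) simp_all
      ultimately show ?thesis by (simp add: abs_mult)
    qed
    thus "summable (\<lambda>n. norm (h n / qpoch a q n * r ^ n))"
      by (intro summable_comparison_test[OF _ *] exI allI impI) (simp only: real_norm_def abs_abs)
  qed
  have key: "conv_radius f \<le> conv_radius g"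
    if sg: "\<And>r::real. summable (\<lambda>n. norm (f n * r ^ n)) \<Longrightarrow> summable (\<lambda>n. norm (g n * r ^ n))"
    for f g :: "nat \<Rightarrow> real"
  proof (rule ccontr)
    assume "\<not> ?thesis"
    hence "conv_radius g < conv_radius f" by simp
    then obtain r where r: "conv_radius g < ereal r" "ereal r < conv_radius f"
      using ereal_dense2 by blast
    have "0 \<le> r" using order_le_less_trans[OF conv_radius_nonneg r(1)] by simp
    have "summable (\<lambda>n. norm (f n * r ^ n))"
      by (rule abs_summable_in_conv_radius) (use r \<open>0 \<le> r\<close> in simp)
    hence "summable (\<lambda>n. g n * r ^ n)" by (rule summable_norm_cancel[OF sg])
    moreover have "\<not> summable (\<lambda>n. g n * r ^ n)"
      by (rule not_summable_outside_conv_radius) (use r \<open>0 \<le> r\<close> in simp)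
    ultimately show False by simp
  qed
  show ?thesis unfolding q_radius_def
    by (intro antisym key) (simp_all only: s)
qed

end

theory Submission
  imports Defs
begin

text \<open>Expanding the products of series as Cauchy products, the difference for the upper bound has
  symmetrized coefficients that are nonpositive because \<open>1 / qpoch a q n\<close> is log-convex in the
  exponent of \<open>a\<close>; the coefficient of \<open>x\<close> is the stated bound. For the lower bound, put
  \<open>a = q powr \<mu>\<close>, \<open>b = q powr (\<mu> + \<beta>)\<close> and
  \<open>F c m = (\<Sum>n. h n * x ^ n / qpoch c q (n + m))\<close>. The quotient of gamma functions is
  \<open>qpoch a q \<alpha> / qpoch b q \<alpha>\<close>, and the claim says that \<open>F a m / F b m\<close> is larger at \<open>m = \<alpha>\<close>
  than at \<open>m = 0\<close>. It increases with each step of \<open>m\<close>, because the coefficients of the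
  corresponding cross difference are telescoping sums weighted by the products
  \<open>h i * h (n - i)\<close>, which are symmetric and unimodal in \<open>i\<close>.\<close>

section \<open>Finite and infinite q-Pochhammer products\<close>

lemma qpoch_0 [simp]: "qpoch a q 0 = 1"
  by (simp add: qpoch_def)

lemma qpoch_Suc: "qpoch a q (Suc n) = qpoch a q n * (1 - a * q ^ n)"
  by (simp add: qpoch_def)

text \<open>Trades a shift of the index for a factor \<open>q ^ m\<close> in the base; the gamma
  quotient, the signs of the coefficients and the shifted series all rest on this.\<close>

lemma qpoch_add: "qpoch a q (m + n) = qpoch a q m * qpoch (a * q ^ m) q n"
  by (induction n) (simp_all add: qpoch_Suc power_add mult.assoc)

lemma qpoch_factor_pos:
  fixes a q :: real
  assumes "0 < q" "q < 1" "0 < a" "a < 1"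
  shows "0 < 1 - a * q ^ k"
proof -
  have "a * q ^ k \<le> a * 1"
    by (rule mult_left_mono) (use assms in \<open>auto intro: power_le_one\<close>)
  thus ?thesis using assms by linarith
qed

lemma qpoch_pos:
  assumes "0 < q" "q < 1" "0 < a" "a < 1"
  shows "0 < qpoch a q n"
  unfolding qpoch_def by (intro prod_pos) (simp only: qpoch_factor_pos[OF assms] simp_thms)

lemma qpoch_antimono:
  assumes "0 < q" "q < 1" "0 < b" "b \<le> a" "a < 1"
  shows "qpoch a q n \<le> qpoch b q n"
  unfolding qpoch_def
proof (rule prod_mono, intro conjI)
  fix k
  show "0 \<le> 1 - a * q ^ k" using qpoch_factor_pos[of q a k] assms by simp
  show "1 - a * q ^ k \<le> 1 - b * q ^ k" using assms by (simp add: mult_right_mono)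
qed

lemma qpoch_inf_limit:
  assumes "0 < q" "q < 1" "0 < a" "a < 1"
  shows "qpoch a q \<longlonglongrightarrow> qpoch_inf a q"
  using qpoch_bounds(1)[OF assms] by (simp add: qpoch_inf_def convergent_LIMSEQ_iff)

text \<open>Positive finite products alone would give only a nonnegative limit; the uniform bound
  \<open>L\<close> keeps it away from 0.\<close>

lemma qpoch_inf_pos:
  assumes "0 < q" "q < 1" "0 < a" "a < 1"
  shows "0 < qpoch_inf a q"
proof -
  obtain L where L: "0 < L" "\<And>n. L \<le> qpoch a q n"
    using qpoch_bounds(2)[OF assms] by blast
  have "L \<le> qpoch_inf a q"
    by (rule LIMSEQ_le_const[OF qpoch_inf_limit[OF assms]]) (use L in auto)
  thus ?thesis using L by linarith
qed

lemma qpoch_inf_shift: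
  assumes "0 < q" "q < 1" "0 < a" "a < 1"
  shows "qpoch_inf a q = qpoch a q m * qpoch_inf (a * q ^ m) q"
proof (rule LIMSEQ_unique)
  have "0 < a * q ^ m" "a * q ^ m < 1"
    using assms qpoch_factor_pos[OF assms, of m] by auto
  from qpoch_inf_limit[OF assms(1,2) this]
  show "(\<lambda>n. qpoch a q (m + n)) \<longlonglongrightarrow> qpoch a q m * qpoch_inf (a * q ^ m) q"
    unfolding qpoch_add by (rule tendsto_mult_left)
  show "(\<lambda>n. qpoch a q (m + n)) \<longlonglongrightarrow> qpoch_inf a q"
    using LIMSEQ_ignore_initial_segment[OF qpoch_inf_limit[OF assms], of m] by (simp add: add.commute)
qed

section \<open>Quotients of the q-gamma function\<close>

lemma q_Gamma_pos:
  assumes "0 < q" "q < 1" "0 < z"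
  shows "0 < q_Gamma q z"
  using assms qpoch_inf_pos[of q q] qpoch_inf_pos[of q "q powr z"] q_powr_less_1[of q z]
  by (simp add: q_Gamma_def)

text \<open>The iterated functional equation: passing from \<open>q powr z\<close> to
  \<open>q powr (z + real m)\<close> removes the first \<open>m\<close> factors of the infinite
  product in the denominator.\<close>

lemma q_Gamma_add_nat:
  assumes "0 < q" "q < 1" "0 < z"
  shows "q_Gamma q (z + real m) = qpoch (q powr z) q m / (1 - q) ^ m * q_Gamma q z"
proof -
  define a where "a = q powr z"
  have a: "0 < a" "a < 1" using assms q_powr_less_1[of q z] by (auto simp: a_def)
  have p: "q powr (z + real m) = a * q ^ m"
    using assms by (simp add: a_def powr_add powr_realpow)
  have s: "(1 - q) powr (1 - (z + real m)) = (1 - q) powr (1 - z) / (1 - q) ^ m"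
    using assms by (simp add: powr_diff powr_add powr_realpow)
  have "0 < qpoch a q m" by (rule qpoch_pos) (use assms a in auto)
  thus ?thesis
    unfolding q_Gamma_def p s a_def[symmetric] qpoch_inf_shift[OF assms(1,2) a, of m]
    by simp
qed

text \<open>Because the shift is a natural number, the gamma values and the powers of
  \<open>1 - q\<close> cancel, leaving only products of \<open>m\<close> factors.\<close>

lemma q_Gamma_quotient:
  assumes "0 < q" "q < 1" "0 < \<mu>" "0 < \<beta>"
  shows "q_Gamma q (\<mu> + real m) * q_Gamma q (\<mu> + \<beta>) /
      (q_Gamma q \<mu> * q_Gamma q (\<mu> + real m + \<beta>)) =
    qpoch (q powr \<mu>) q m / qpoch (q powr (\<mu> + \<beta>)) q m"
proof -
  have e: "\<mu> + real m + \<beta> = \<mu> + \<beta> + real m" by simp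
  have "0 < q_Gamma q \<mu>" "0 < q_Gamma q (\<mu> + \<beta>)"
    using assms by (auto intro: q_Gamma_pos)
  moreover have "0 < 1 - q" using assms by simp
  moreover have "0 < qpoch (q powr (\<mu> + \<beta>)) q m"
    using assms by (intro qpoch_pos q_powr_less_1) auto
  ultimately show ?thesis
    unfolding e q_Gamma_add_nat[OF assms(1-3)] q_Gamma_add_nat[OF assms(1,2) add_pos_pos[OF assms(3,4)]]
    by (simp add: field_simps)
qed

section \<open>Log-concavity of q-Pochhammer products and the signs of coefficients\<close>

text \<open>Compared factor by factor, right minus left is
  \<open>a * q ^ k * ((1 - s) * (1 - t))\<close>, which is positive; strictness needs at least one
  factor.\<close>

lemma qpoch_log_concave:
  assumes q: "0 < q" "q < 1" and a: "0 < a" "a < 1" and s: "0 < s" "s < 1" and t: "0 < t" "t < 1"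
  shows "qpoch a q n * qpoch (a * s * t) q n \<le> qpoch (a * s) q n * qpoch (a * t) q n"
    and "0 < n \<Longrightarrow> qpoch a q n * qpoch (a * s * t) q n < qpoch (a * s) q n * qpoch (a * t) q n"
proof -
  have lt: "(1 - a * q ^ k) * (1 - a * s * t * q ^ k) < (1 - a * s * q ^ k) * (1 - a * t * q ^ k)" for k
  proof -
    have "0 < a * q ^ k * ((1 - s) * (1 - t))"
      using assms by (intro mult_pos_pos) auto
    thus ?thesis by (simp add: algebra_simps)
  qed
  have "a * s * t \<le> a * s" "a * s \<le> a"
    using assms by (simp_all add: mult_left_le)
  with a have "a * s * t < 1" by linarith
  hence nn: "0 \<le> (1 - a * q ^ k) * (1 - a * s * t * q ^ k)" for k
    using qpoch_factor_pos[OF q a, of k] qpoch_factor_pos[OF q, of "a * s * t" k] a s t by simp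
  show "qpoch a q n * qpoch (a * s * t) q n \<le> qpoch (a * s) q n * qpoch (a * t) q n"
    unfolding qpoch_def prod.distrib[symmetric] using lt nn
    by (intro prod_mono) (auto intro: less_imp_le)
  show "qpoch a q n * qpoch (a * s * t) q n < qpoch (a * s) q n * qpoch (a * t) q n" if "0 < n"
    unfolding qpoch_def prod.distrib[symmetric] using lt nn that
    by (intro prod_mono_strict) (auto intro: less_imp_le le_less_trans)
qed

text \<open>Expanding \<open>(r - x) * (r - y) \<ge> 0\<close> gives
  \<open>(x + y) * r \<le> r * r + x * y\<close>, where \<open>x * y \<le> p * r\<close>; then
  \<open>r\<close> cancels. This passes from log-convexity to convexity.\<close>

lemma add_le_of_mult_le:
  fixes p x y r :: real
  assumes "0 < r" "x \<le> r" "y \<le> r" "x * y \<le> p * r"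
  shows "x + y \<le> p + r"
proof -
  have "0 \<le> (r - x) * (r - y)" using assms by simp
  hence "(x + y) * r \<le> (p + r) * r" using assms by (simp add: algebra_simps)
  thus ?thesis using assms by simp
qed

text \<open>With \<open>a = q powr \<mu>\<close>, \<open>s = q powr \<alpha>\<close> and
  \<open>t = q powr \<beta>\<close>, this is the factor of \<open>h i * h j * x ^ (i + j)\<close> in
  \<open>q_Delta\<close>. It has no fixed sign by itself; only its symmetrization in
  \<open>i\<close> and \<open>j\<close> has one.\<close>

definition qcoeff :: "real \<Rightarrow> real \<Rightarrow> real \<Rightarrow> real \<Rightarrow> nat \<Rightarrow> nat \<Rightarrow> real" where
  "qcoeff q a s t i j = 1 / (qpoch (a * s) q i * qpoch (a * t) q j)
     - 1 / (qpoch a q i * qpoch (a * s * t) q j)"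

context
  fixes q a s t :: real
  assumes q: "0 < q" "q < 1" and a: "0 < a" "a < 1" and s: "0 < s" "s < 1" and t: "0 < t" "t < 1"
begin

lemma nodes_bounds: "0 < a * s" "a * s < 1" "0 < a * t" "a * t < 1" "0 < a * s * t" "a * s * t < 1"
  "a * s * t \<le> a * s" "a * s * t \<le> a * t" "a * s \<le> a" "a * t \<le> a"
proof -
  show 1: "0 < a * s" "0 < a * t" "0 < a * s * t" using a s t by auto
  show 2: "a * s \<le> a" "a * t \<le> a" using a s t by auto
  show "a * s < 1" "a * t < 1" using 2 a by linarith+
  show 3: "a * s * t \<le> a * s" using 1 t by (simp add: mult_left_le)
  show "a * s * t \<le> a * t" using 1 2 t by (simp add: mult_right_mono)
  show "a * s * t < 1" using 3 2 a by linarith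
qed

lemmas qpoch_nodes_pos = qpoch_pos[OF q a] qpoch_pos[OF q nodes_bounds(1,2)]
  qpoch_pos[OF q nodes_bounds(3,4)] qpoch_pos[OF q nodes_bounds(5,6)]

lemma recip_qpoch_log_convex:
  "1 / qpoch (a * s) q n * (1 / qpoch (a * t) q n) \<le> 1 / qpoch (a * s * t) q n * (1 / qpoch a q n)"
  using qpoch_log_concave(1)[OF q a s t, of n] qpoch_nodes_pos[of n]
  by (simp add: frac_le mult.commute)

text \<open>Here \<open>add_le_of_mult_le\<close> applies with \<open>r = 1 / qpoch a q n\<close>:
  the base \<open>a\<close> is the largest, so its reciprocal dominates those at
  \<open>a * s\<close> and \<open>a * t\<close>.\<close>

lemma recip_qpoch_convex:
  "1 / qpoch (a * s) q n + 1 / qpoch (a * t) q n \<le> 1 / qpoch (a * s * t) q n + 1 / qpoch a q n"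
proof (rule add_le_of_mult_le[OF _ _ _ recip_qpoch_log_convex])
  show "0 < 1 / qpoch a q n" using qpoch_nodes_pos by simp
  show "1 / qpoch (a * s) q n \<le> 1 / qpoch a q n" "1 / qpoch (a * t) q n \<le> 1 / qpoch a q n"
    using qpoch_nodes_pos qpoch_antimono[OF q nodes_bounds(1,9) a(2)]
      qpoch_antimono[OF q nodes_bounds(3,10) a(2)] by (auto intro!: divide_left_mono mult_pos_pos)
qed

text \<open>The strict case of log-concavity; the diagonal terms decide when the upper bound is
  attained.\<close>

lemma qcoeff_diag_neg: "0 < n \<Longrightarrow> qcoeff q a s t n n < 0"
  using qpoch_log_concave(2)[OF q a s t, of n] qpoch_nodes_pos[of n]
  by (simp add: qcoeff_def frac_less2)

end

text \<open>For \<open>j = i + k\<close>, split the first \<open>i\<close> factors off every product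
  of length \<open>i + k\<close>. Log-convexity bounds the part of length \<open>i\<close>,
  convexity at the base \<open>b = a * q ^ i\<close> bounds the remaining sums of length
  \<open>k\<close>, and the two inequalities multiply.\<close>

lemma qcoeff_sym_nonpos:
  assumes q: "0 < q" "q < 1" and a: "0 < a" "a < 1" and s: "0 < s" "s < 1" and t: "0 < t" "t < 1"
  shows "qcoeff q a s t i j + qcoeff q a s t j i \<le> 0"
proof -
  have main: "qcoeff q a s t i (i + k) + qcoeff q a s t (i + k) i \<le> 0" for i k
  proof -
    define b where "b = a * q ^ i"
    have b: "0 < b" "b < 1" using qpoch_factor_pos[OF q a, of i] a q by (auto simp: b_def)
    define u where "u c n = 1 / qpoch c q n" for c n
    have sp: "u c (i + k) = u c i * u (c * q ^ i) k" for c
      by (simp add: u_def qpoch_add)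
    have e: "a * s * q ^ i = b * s" "a * t * q ^ i = b * t" "a * s * t * q ^ i = b * s * t" "a * q ^ i = b"
      by (simp_all add: b_def)
    have "u (a * s) i * u (a * t) i * (u (b * s) k + u (b * t) k)
        \<le> u (a * s * t) i * u a i * (u (b * s * t) k + u b k)"
    proof (rule mult_mono)
      show "u (a * s) i * u (a * t) i \<le> u (a * s * t) i * u a i"
        unfolding u_def by (rule recip_qpoch_log_convex[OF assms])
      show "u (b * s) k + u (b * t) k \<le> u (b * s * t) k + u b k"
        unfolding u_def by (rule recip_qpoch_convex[OF q b s t])
      show "0 \<le> u (a * s * t) i * u a i" "0 \<le> u (b * s) k + u (b * t) k"
        using qpoch_nodes_pos[OF assms, of i] qpoch_nodes_pos[OF q b s t, of k]
        by (auto simp: u_def)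
    qed
    moreover have "qcoeff q a s t i j = u (a * s) i * u (a * t) j - u a i * u (a * s * t) j" for i j
      by (simp add: qcoeff_def u_def)
    ultimately show ?thesis
      by (simp only: sp e) (simp add: algebra_simps)
  qed
  show ?thesis
  proof (cases "i \<le> j")
    case True
    thus ?thesis using main[of i "j - i"] by simp
  next
    case False
    thus ?thesis using main[of j "i - j"] by (simp add: add.commute)
  qed
qed

section \<open>The power series of \<open>q_Delta\<close> and its upper bound\<close>

lemma sum_antidiagonal_sym:
  fixes f :: "nat \<Rightarrow> nat \<Rightarrow> real"
  shows "2 * (\<Sum>i\<le>n. f i (n - i)) = (\<Sum>i\<le>n. f i (n - i) + f (n - i) i)"
proof -
  have "(\<Sum>i\<le>n. f i (n - i)) = (\<Sum>i\<le>n. f (n - i) i)"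
    by (rule sum.reindex_bij_witness[of _ "\<lambda>i. n - i" "\<lambda>i. n - i"]) auto
  thus ?thesis by (simp add: sum.distrib)
qed

lemma q_series_abs_summable:
  assumes "0 < q" "q < 1" "0 < a" "a < 1" "0 \<le> x" "ereal x < conv_radius h"
  shows "summable (\<lambda>n. norm (h n * x ^ n / qpoch a q n))"
proof -
  have "summable (\<lambda>n. norm (h n / qpoch a q n * x ^ n))"
    by (rule abs_summable_in_conv_radius)
      (use assms q_radius_indep[of q a h] in \<open>simp add: q_radius_def\<close>)
  thus ?thesis by (simp only: times_divide_eq_left)
qed

lemma q_Delta_series:
  assumes q: "0 < q" "q < 1" and pos: "0 < \<mu>" "0 < \<alpha>" "0 < \<beta>"
    and x: "0 \<le> x" "ereal x < conv_radius h"
  shows "(\<lambda>n. \<Sum>i\<le>n. h i * h (n - i) * x ^ n *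
      qcoeff q (q powr \<mu>) (q powr \<alpha>) (q powr \<beta>) i (n - i)) sums q_Delta q h \<mu> \<alpha> \<beta> x"
proof -
  have S: "summable (\<lambda>n. norm (h n * x ^ n / qpoch (q powr z) q n))" if "0 < z" for z
    using q x that by (intro q_series_abs_summable q_powr_less_1) auto
  have C: "(\<lambda>n. \<Sum>i\<le>n. h i * x ^ i / qpoch (q powr y) q i *
      (h (n - i) * x ^ (n - i) / qpoch (q powr z) q (n - i)))
      sums (q_series q h (q powr y) x * q_series q h (q powr z) x)" if "0 < y" "0 < z" for y z
    unfolding q_series_def by (rule Cauchy_product_sums[OF S S]) (use that in auto)
  have "(\<lambda>n. (\<Sum>i\<le>n. h i * x ^ i / qpoch (q powr (\<mu> + \<alpha>)) q i *
        (h (n - i) * x ^ (n - i) / qpoch (q powr (\<mu> + \<beta>)) q (n - i)))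
      - (\<Sum>i\<le>n. h i * x ^ i / qpoch (q powr \<mu>) q i *
        (h (n - i) * x ^ (n - i) / qpoch (q powr (\<mu> + \<alpha> + \<beta>)) q (n - i)))) sums q_Delta q h \<mu> \<alpha> \<beta> x"
    unfolding q_Delta_def by (intro sums_diff C) (use pos in auto)
  moreover have "(\<Sum>i\<le>n. h i * x ^ i / qpoch (q powr (\<mu> + \<alpha>)) q i *
        (h (n - i) * x ^ (n - i) / qpoch (q powr (\<mu> + \<beta>)) q (n - i)))
      - (\<Sum>i\<le>n. h i * x ^ i / qpoch (q powr \<mu>) q i *
        (h (n - i) * x ^ (n - i) / qpoch (q powr (\<mu> + \<alpha> + \<beta>)) q (n - i)))
      = (\<Sum>i\<le>n. h i * h (n - i) * x ^ n *
          qcoeff q (q powr \<mu>) (q powr \<alpha>) (q powr \<beta>) i (n - i))" for n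
    unfolding sum_subtractf[symmetric]
  proof (rule sum.cong[OF refl])
    fix i assume "i \<in> {..n}"
    hence xn: "x ^ n = x ^ i * x ^ (n - i)" by (simp add: power_add[symmetric])
    show "h i * x ^ i / qpoch (q powr (\<mu> + \<alpha>)) q i *
        (h (n - i) * x ^ (n - i) / qpoch (q powr (\<mu> + \<beta>)) q (n - i))
      - h i * x ^ i / qpoch (q powr \<mu>) q i *
        (h (n - i) * x ^ (n - i) / qpoch (q powr (\<mu> + \<alpha> + \<beta>)) q (n - i))
      = h i * h (n - i) * x ^ n * qcoeff q (q powr \<mu>) (q powr \<alpha>) (q powr \<beta>) i (n - i)"
      unfolding qcoeff_def xn powr_add by (simp add: right_diff_distrib mult_ac)
  qed
  ultimately show ?thesis by simp
qed

text \<open>All terms \<open>d n\<close> of the power series are nonpositive, so keeping only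
  \<open>d 1\<close>, which equals \<open>U\<close>, bounds the sum from above. If
  \<open>x \<noteq> 0\<close> and \<open>h n \<noteq> 0\<close> for some \<open>n \<ge> 1\<close>,
  the discarded term \<open>d (2 * n)\<close> is negative and the bound is strict.\<close>

lemma q_Delta_upper:
  assumes q: "0 < q" "q < 1" and pos: "0 < \<mu>" "0 < \<alpha>" "0 < \<beta>"
    and x: "0 \<le> x" "ereal x < conv_radius h" and h: "\<And>n. 0 \<le> h n"
  defines "U \<equiv> - (h 0 * h 1 * x * q powr \<mu> * (1 - q powr \<alpha>) * (1 - q powr \<beta>)
                      * (1 - q powr (2 * \<mu> + \<alpha> + \<beta>)))
                   / ((1 - q powr \<mu>) * (1 - q powr (\<mu> + \<alpha> + \<beta>))
                      * (1 - q powr (\<mu> + \<alpha>)) * (1 - q powr (\<mu> + \<beta>)))"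
  shows "U \<le> 0" "q_Delta q h \<mu> \<alpha> \<beta> x \<le> U"
    and "q_Delta q h \<mu> \<alpha> \<beta> x = U \<longleftrightarrow> x = 0 \<or> (\<forall>n\<ge>1. h n = 0)"
    and "q_Delta q h \<mu> \<alpha> \<beta> x = 0 \<longleftrightarrow> x = 0 \<or> (\<forall>n\<ge>1. h n = 0)"
proof -
  define a s t where "a = q powr \<mu>" and "s = q powr \<alpha>" and "t = q powr \<beta>"
  have b: "0 < a" "a < 1" "0 < s" "s < 1" "0 < t" "t < 1"
    using q pos by (auto simp: a_def s_def t_def q_powr_less_1)
  define d where "d n = (\<Sum>i\<le>n. h i * h (n - i) * x ^ n * qcoeff q a s t i (n - i))" for n
  have d: "d sums q_Delta q h \<mu> \<alpha> \<beta> x"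
    unfolding d_def a_def s_def t_def by (rule q_Delta_series[OF q pos x])
  \<comment> \<open>Isolates the fraction evaluated in \<open>q_Delta_linear_coeff\<close>; its four
    reciprocals come from the pairs \<open>(0, 1)\<close> and \<open>(1, 0)\<close>.\<close>
  have "U = h 0 * h 1 * x * (- (q powr \<mu> * (1 - q powr \<alpha>) * (1 - q powr \<beta>)
                      * (1 - q powr (2 * \<mu> + \<alpha> + \<beta>)))
                   / ((1 - q powr \<mu>) * (1 - q powr (\<mu> + \<alpha> + \<beta>))
                      * (1 - q powr (\<mu> + \<alpha>)) * (1 - q powr (\<mu> + \<beta>))))"
    by (simp add: U_def)
  also have "\<dots> = d 1"
    unfolding q_Delta_linear_coeff[OF q pos, symmetric]
    by (simp add: d_def qcoeff_def a_def s_def t_def powr_add algebra_simps)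
  finally have U: "U = d 1" .
  have sym: "2 * d n = (\<Sum>i\<le>n. h i * h (n - i) * x ^ n *
      (qcoeff q a s t i (n - i) + qcoeff q a s t (n - i) i))" for n
    unfolding d_def
    using sum_antidiagonal_sym[of "\<lambda>i j. h i * h j * x ^ n * qcoeff q a s t i j" n]
    by (simp add: algebra_simps)
  have coeff: "h i * h (n - i) * x ^ n * (qcoeff q a s t i (n - i) + qcoeff q a s t (n - i) i) \<le> 0" for i n
    using h x qcoeff_sym_nonpos[OF q b] by (intro mult_nonneg_nonpos) auto
  have nonpos: "d n \<le> 0" for n
  proof -
    have "2 * d n \<le> 0" unfolding sym by (rule sum_nonpos) (rule coeff)
    thus ?thesis by simp
  qed
  \<comment> \<open>The antidiagonal of index \<open>2 * n\<close> contains the pair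
    \<open>(n, n)\<close>, whose weight \<open>h n * h n\<close> is positive whatever the other
    entries are.\<close>
  have neg: "d (2 * n) < 0" if "n \<ge> 1" "h n \<noteq> 0" "x \<noteq> 0" for n
  proof -
    have "2 * d (2 * n) \<le> h n * h n * x ^ (2 * n) * (qcoeff q a s t n n + qcoeff q a s t n n)"
    proof -
      have "2 * d (2 * n) = h n * h (2 * n - n) * x ^ (2 * n) *
            (qcoeff q a s t n (2 * n - n) + qcoeff q a s t (2 * n - n) n)
          + (\<Sum>i\<in>{..2 * n} - {n}. h i * h (2 * n - i) * x ^ (2 * n) *
            (qcoeff q a s t i (2 * n - i) + qcoeff q a s t (2 * n - i) i))"
        unfolding sym by (rule sum.remove) auto
      moreover have "(\<Sum>i\<in>{..2 * n} - {n}. h i * h (2 * n - i) * x ^ (2 * n) *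
            (qcoeff q a s t i (2 * n - i) + qcoeff q a s t (2 * n - i) i)) \<le> 0"
        by (rule sum_nonpos) (rule coeff)
      ultimately show ?thesis by simp
    qed
    moreover have "h n * h n * x ^ (2 * n) * (qcoeff q a s t n n + qcoeff q a s t n n) < 0"
      using that h[of n] x qcoeff_diag_neg[OF q b, of n]
      by (intro mult_pos_neg mult_pos_pos) auto
    ultimately show ?thesis by linarith
  qed
  show U0: "U \<le> 0" using nonpos U by simp
  \<comment> \<open>The discarded terms with their sign reversed: \<open>e\<close> is 0 at index 1
    and \<open>- d n\<close> elsewhere. As \<open>2 * n \<noteq> 1\<close>, the negative terms found
    above survive in it.\<close>
  define e where "e n = (if n = 1 then d n else 0) - d n" for n
  have e: "e sums (U - q_Delta q h \<mu> \<alpha> \<beta> x)"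
    unfolding e_def U by (intro sums_diff d sums_single)
  have e0: "0 \<le> e n" for n using nonpos[of n] by (simp add: e_def)
  show le: "q_Delta q h \<mu> \<alpha> \<beta> x \<le> U"
    using sums_le[OF e0 sums_zero e] by simp
  show eq_iff: "q_Delta q h \<mu> \<alpha> \<beta> x = U \<longleftrightarrow> x = 0 \<or> (\<forall>n\<ge>1. h n = 0)"
  proof
    assume eq: "q_Delta q h \<mu> \<alpha> \<beta> x = U"
    show "x = 0 \<or> (\<forall>n\<ge>1. h n = 0)"
    proof (rule ccontr)
      assume "\<not> ?thesis"
      then obtain n where n: "n \<ge> 1" "h n \<noteq> 0" "x \<noteq> 0" by auto
      have "0 < e (2 * n)" using neg[OF n] by (auto simp: e_def)
      hence "0 < suminf e" by (rule suminf_pos2[OF sums_summable[OF e] e0])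
      thus False using eq sums_unique[OF e] by simp
    qed
  next
    assume z: "x = 0 \<or> (\<forall>n\<ge>1. h n = 0)"
    \<comment> \<open>For \<open>n = 0\<close> the two products in \<open>qcoeff\<close> cancel;
      otherwise one of \<open>i\<close> and \<open>n - i\<close> is positive, so \<open>h\<close> or
      the power of \<open>x\<close> vanishes.\<close>
    have "h i * h (n - i) * x ^ n * qcoeff q a s t i (n - i) = 0" if "i \<le> n" for i n
    proof (cases "n = 0")
      case True
      thus ?thesis using that by (simp add: qcoeff_def)
    next
      case False
      hence "i \<ge> 1 \<or> n - i \<ge> 1" using that by linarith
      thus ?thesis using z False by auto
    qed
    hence "d = (\<lambda>n. 0)" unfolding d_def by (intro ext sum.neutral) auto
    thus "q_Delta q h \<mu> \<alpha> \<beta> x = U" using d U by (simp add: sums_iff)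
  qed
  show "q_Delta q h \<mu> \<alpha> \<beta> x = 0 \<longleftrightarrow> x = 0 \<or> (\<forall>n\<ge>1. h n = 0)"
  proof
    assume "q_Delta q h \<mu> \<alpha> \<beta> x = 0"
    with U0 le have "q_Delta q h \<mu> \<alpha> \<beta> x = U" by simp
    thus "x = 0 \<or> (\<forall>n\<ge>1. h n = 0)" using eq_iff by blast
  next
    assume z: "x = 0 \<or> (\<forall>n\<ge>1. h n = 0)"
    hence "U = 0" by (auto simp: U_def)
    thus "q_Delta q h \<mu> \<alpha> \<beta> x = 0" using eq_iff z by simp
  qed
qed

section \<open>Doubly positive weights and cross differences of series\<close>

text \<open>Multiply the inequality for \<open>k\<close> by log-concavity at \<open>k + 2\<close>
  and cancel \<open>h (k + 1) * h (k + 2)\<close>. It makes \<open>h i * h (n - i)\<close> grow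
  towards the middle.\<close>

lemma doubly_positive_shift:
  assumes "doubly_positive h" "j \<le> k"
  shows "h j * h (k + 2) \<le> h (j + 1) * h (k + 1)"
  using assms(2)
proof (induction rule: dec_induct)
  case base
  have "h ((j + 1) - 1) * h ((j + 1) + 1) \<le> (h (j + 1))\<^sup>2"
    using assms(1) unfolding doubly_positive_def by (meson le_add2)
  thus ?case by (simp add: power2_eq_square)
next
  case (step k)
  have nn: "0 \<le> h n" for n using assms(1) by (simp add: doubly_positive_def)
  \<comment> \<open>Absence of internal zeros makes the cancelled factors nonzero. The sequence 1,
    0, 0, 1, 0, 0, ... is log-concave, yet \<open>h 0 * h 3 \<le> h 1 * h 2\<close> fails for
    it.\<close>
  have gap: "h l \<noteq> 0" if "h j \<noteq> 0" "h (k + 3) \<noteq> 0" "j \<le> l" "l \<le> k + 3" for l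
  proof
    assume "h l = 0"
    hence "(\<forall>i. h (l + i) = 0) \<or> (\<forall>i\<le>l. h (l - i) = 0)"
      using assms(1) by (simp add: doubly_positive_def)
    thus False
    proof
      assume *: "\<forall>i. h (l + i) = 0"
      show False using *[rule_format, of "k + 3 - l"] that by simp
    next
      assume *: "\<forall>i\<le>l. h (l - i) = 0"
      show False using *[rule_format, of "l - j"] that by simp
    qed
  qed
  show ?case
  proof (cases "h j = 0 \<or> h (k + 3) = 0")
    case True
    thus ?thesis using nn by (auto simp: numeral_3_eq_3)
  next
    case False
    hence p: "0 < h (k + 1)" "0 < h (k + 2)"
      using gap[of "k + 1"] gap[of "k + 2"] step nn[of "k + 1"] nn[of "k + 2"] by (auto simp: less_le)
    have "h ((k + 2) - 1) * h ((k + 2) + 1) \<le> (h (k + 2))\<^sup>2"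
      using assms(1) unfolding doubly_positive_def by (metis le_add2 one_le_numeral order_trans)
    hence "h (k + 1) * h (k + 3) \<le> h (k + 2) * h (k + 2)" by (simp add: power2_eq_square numeral_3_eq_3)
    hence "(h j * h (k + 2)) * (h (k + 1) * h (k + 3)) \<le> (h (j + 1) * h (k + 1)) * (h (k + 2) * h (k + 2))"
      by (rule mult_mono[OF step.IH]) (use nn in auto)
    hence "(h j * h (k + 3)) * (h (k + 1) * h (k + 2)) \<le> (h (j + 1) * h (k + 2)) * (h (k + 1) * h (k + 2))"
      by (simp add: mult_ac)
    hence "h j * h (k + 3) \<le> h (j + 1) * h (k + 2)"
      using p by (simp add: mult_le_cancel_right)
    thus ?thesis by (simp add: numeral_3_eq_3)
  qed
qed

text \<open>Summation by parts over the centred windows \<open>{L..n - L}\<close>, on which the increments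
  of \<open>T\<close> telescope to a nonnegative number.\<close>

lemma sym_unimodal_sum_ge:
  fixes w T :: "nat \<Rightarrow> real"
  assumes "\<And>i. i \<le> n \<Longrightarrow> w (n - i) = w i"
    and "\<And>i. 2 * i + 2 \<le> n \<Longrightarrow> w i \<le> w (Suc i)"
    and "\<And>i. 2 * i \<le> n \<Longrightarrow> T i \<le> T (Suc n - i)"
  shows "w 0 * (T (Suc n) - T 0) \<le> (\<Sum>i\<le>n. w i * (T (Suc i) - T i))"
  using assms
proof (induction n arbitrary: w T rule: nat_induct2)
  case 1
  have "w 1 = w 0" using "1.prems"(1)[of 0] by simp
  thus ?case by (simp add: algebra_simps)
next
  case (step n)
  have w: "w (Suc (Suc n)) = w 0" using step.prems(1)[of 0] by simp
  have T: "T 1 \<le> T (Suc (Suc n))" using step.prems(3)[of 1] by simp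
  \<comment> \<open>Both end terms have weight \<open>w 0\<close>. The inner window is the case
    \<open>n\<close> for \<open>w\<close> and \<open>T\<close> shifted by one; its total increment
    is nonnegative, so \<open>w 1\<close> may be lowered to \<open>w 0\<close>, after which all
    increments telescope.\<close>
  have "w 1 * (T (Suc (Suc n)) - T 1) \<le> (\<Sum>i\<le>n. w (Suc i) * (T (Suc (Suc i)) - T (Suc i)))"
    unfolding One_nat_def
  proof (rule step.IH)
    fix i
    show "w (Suc (n - i)) = w (Suc i)" if "i \<le> n"
      using step.prems(1)[of "Suc i"] that by (simp add: Suc_diff_le)
    show "w (Suc i) \<le> w (Suc (Suc i))" if "2 * i + 2 \<le> n"
      using step.prems(2)[of "Suc i"] that by simp
    show "T (Suc i) \<le> T (Suc (Suc n - i))" if "2 * i \<le> n"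
      using step.prems(3)[of "Suc i"] that by (simp add: Suc_diff_le)
  qed
  moreover have "w 0 * (T (Suc (Suc n)) - T 1) \<le> w 1 * (T (Suc (Suc n)) - T 1)"
    using T step.prems(2)[of 0] by (intro mult_right_mono) auto
  moreover have "(\<Sum>i\<le>n + 2. w i * (T (Suc i) - T i)) = w 0 * (T 1 - T 0) +
      (\<Sum>i\<le>n. w (Suc i) * (T (Suc (Suc i)) - T (Suc i))) + w 0 * (T (Suc (Suc (Suc n))) - T (Suc (Suc n)))"
  proof -
    have "(\<Sum>i\<le>n + 2. g i) = g 0 + (\<Sum>i\<le>n. g (Suc i)) + g (Suc (Suc n))" for g :: "nat \<Rightarrow> real"
      by (simp only: add_2_eq_Suc' sum.atMost_Suc_shift[of _ "Suc n"]) simp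
    thus ?thesis by (simp add: w del: add_2_eq_Suc')
  qed
  ultimately show ?case by (simp add: algebra_simps)
qed simp

text \<open>\<open>AB\<close> is the cross-multiplied form of \<open>A / B\<close> being strictly
  increasing. The coefficients \<open>c n\<close> of right minus left are nonnegative by
  \<open>sym_unimodal_sum_ge\<close>, and one of them is positive.\<close>

lemma shifted_series_ratio_less:
  fixes A B h :: "nat \<Rightarrow> real"
  assumes h: "doubly_positive h" and x: "0 \<le> x" "x \<noteq> 0 \<or> h 0 \<noteq> 0"
    and AB: "\<And>i j. i < j \<Longrightarrow> A i * B j < A j * B i"
    and summable: "summable (\<lambda>n. norm (h n * x ^ n * A n))" "summable (\<lambda>n. norm (h n * x ^ n * A (Suc n)))"
      "summable (\<lambda>n. norm (h n * x ^ n * B n))" "summable (\<lambda>n. norm (h n * x ^ n * B (Suc n)))"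
  shows "(\<Sum>n. h n * x ^ n * A n) * (\<Sum>n. h n * x ^ n * B (Suc n))
    < (\<Sum>n. h n * x ^ n * A (Suc n)) * (\<Sum>n. h n * x ^ n * B n)"
proof -
  have nn: "0 \<le> h n" for n using h by (simp add: doubly_positive_def)
  \<comment> \<open>The two products in the \<open>n\<close>-th coefficient are
    \<open>T n (Suc i)\<close> and \<open>T n i\<close>, and \<open>AB\<close> compares
    \<open>T n\<close> at the mirror positions \<open>i\<close> and
    \<open>Suc n - i\<close>.\<close>
  define T where "T n i = A i * B (Suc n - i)" for n i
  define c where "c n = x ^ n * (\<Sum>i\<le>n. h i * h (n - i) * (T n (Suc i) - T n i))" for n
  have "(\<lambda>n. (\<Sum>i\<le>n. (h i * x ^ i * A (Suc i)) * (h (n - i) * x ^ (n - i) * B (n - i)))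
      - (\<Sum>i\<le>n. (h i * x ^ i * A i) * (h (n - i) * x ^ (n - i) * B (Suc (n - i))))) sums
    ((\<Sum>n. h n * x ^ n * A (Suc n)) * (\<Sum>n. h n * x ^ n * B n)
      - (\<Sum>n. h n * x ^ n * A n) * (\<Sum>n. h n * x ^ n * B (Suc n)))" (is "?f sums ?S")
    by (intro sums_diff Cauchy_product_sums summable)
  moreover have "?f n = c n" for n
    unfolding c_def sum_subtractf[symmetric] sum_distrib_left
  proof (rule sum.cong[OF refl])
    fix i assume "i \<in> {..n}"
    hence xn: "x ^ n = x ^ i * x ^ (n - i)" and "Suc n - i = Suc (n - i)"
      by (simp_all add: power_add[symmetric] Suc_diff_le)
    thus "h i * x ^ i * A (Suc i) * (h (n - i) * x ^ (n - i) * B (n - i))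
        - h i * x ^ i * A i * (h (n - i) * x ^ (n - i) * B (Suc (n - i)))
      = x ^ n * (h i * h (n - i) * (T n (Suc i) - T n i))"
      unfolding T_def xn by (simp add: algebra_simps)
  qed
  ultimately have c: "c sums ?S" by simp
  have c0: "0 \<le> c n" for n
  proof -
    have T: "T n i \<le> T n (Suc n - i)" if "2 * i \<le> n" for i
      using AB[of i "Suc n - i"] that by (auto simp: T_def less_imp_le)
    have "h 0 * h (n - 0) * (T n (Suc n) - T n 0) \<le> (\<Sum>i\<le>n. h i * h (n - i) * (T n (Suc i) - T n i))"
    proof (rule sym_unimodal_sum_ge[where w = "\<lambda>i. h i * h (n - i)"])
      \<comment> \<open>Taking \<open>k = n - i - 2\<close> makes \<open>k + 2\<close> equal to
        \<open>n - i\<close>, and \<open>i \<le> k\<close> is exactly the assumption.\<close>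
      fix i assume "2 * i + 2 \<le> n"
      thus "h i * h (n - i) \<le> h (Suc i) * h (n - Suc i)"
        using doubly_positive_shift[OF h, of i "n - i - 2"]
        by (simp add: Suc_diff_Suc numeral_2_eq_2)
    qed (auto intro: T)
    moreover have "0 \<le> h 0 * h (n - 0) * (T n (Suc n) - T n 0)"
      using nn T[of 0] by (intro mult_nonneg_nonneg) auto
    ultimately show ?thesis using x by (simp add: c_def)
  qed
  \<comment> \<open>At index \<open>2 * m\<close>, any \<open>i \<noteq> m\<close> puts
    \<open>i\<close> or \<open>2 * m - i\<close> below the first nonzero entry of \<open>h\<close>,
    so only \<open>i = m\<close> contributes, with a strictly positive increment.\<close>
  define m where "m = (LEAST n. h n \<noteq> 0)"
  have "\<exists>n. h n \<noteq> 0" using h by (simp add: doubly_positive_def)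
  hence m: "h m \<noteq> 0" unfolding m_def by (rule LeastI_ex)
  have below: "h i = 0" if "i < m" for i using not_less_Least[of i "\<lambda>n. h n \<noteq> 0"] that by (auto simp: m_def)
  have "(\<Sum>i\<le>2 * m. h i * h (2 * m - i) * (T (2 * m) (Suc i) - T (2 * m) i))
      = (\<Sum>i\<in>{m}. h i * h (2 * m - i) * (T (2 * m) (Suc i) - T (2 * m) i))"
  proof (rule sum.mono_neutral_right)
    show "\<forall>i\<in>{..2 * m} - {m}. h i * h (2 * m - i) * (T (2 * m) (Suc i) - T (2 * m) i) = 0"
    proof
      fix i assume "i \<in> {..2 * m} - {m}"
      hence "i < m \<or> 2 * m - i < m" by auto
      thus "h i * h (2 * m - i) * (T (2 * m) (Suc i) - T (2 * m) i) = 0" using below by auto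
    qed
  qed auto
  hence "c (2 * m) = x ^ (2 * m) * (h m * h m * (A (Suc m) * B m - A m * B (Suc m)))"
    by (simp add: c_def T_def Suc_diff_le)
  moreover have "0 < x ^ (2 * m)"
  proof (cases "x = 0")
    case True
    \<comment> \<open>For \<open>x = 0\<close> the hypothesis gives \<open>h 0 \<noteq> 0\<close>,
      and \<open>0 ^ 0 = 1\<close>.\<close>
    hence "m = 0" using x unfolding m_def by (intro Least_eq_0) auto
    thus ?thesis by simp
  qed (use x in auto)
  moreover have "0 < h m" using m nn[of m] by simp
  ultimately have "0 < c (2 * m)" using AB[of m "Suc m"] by simp
  hence "0 < suminf c" by (rule suminf_pos2[OF sums_summable[OF c] c0])
  thus ?thesis using sums_unique[OF c] by simp
qed

section \<open>The lower bound for products of q-series\<close>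

lemma q_series_pos:
  assumes q: "0 < q" "q < 1" and a: "0 < a" "a < 1" and h: "doubly_positive h"
    and x: "0 \<le> x" "x \<noteq> 0 \<or> h 0 \<noteq> 0" "ereal x < conv_radius h"
  shows "0 < q_series q h a x"
proof -
  have nn: "0 \<le> h n" for n using h by (simp add: doubly_positive_def)
  \<comment> \<open>A positive term: any index with a nonzero entry if \<open>x \<noteq> 0\<close>,
    and the constant term if \<open>x = 0\<close>.\<close>
  obtain m where m: "h m \<noteq> 0" "x \<noteq> 0 \<or> m = 0"
    using x h unfolding doubly_positive_def by blast
  show ?thesis unfolding q_series_def
  proof (rule suminf_pos2[where i = m])
    show "summable (\<lambda>n. h n * x ^ n / qpoch a q n)"
      by (rule summable_norm_cancel[OF q_series_abs_summable[OF q a x(1,3)]])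
    show "0 \<le> h n * x ^ n / qpoch a q n" for n using nn x qpoch_pos[OF q a, of n] by simp
    have "0 < h m" using m(1) nn[of m] by linarith
    moreover have "0 < x ^ m" using m(2) x(1) by (cases "x = 0") simp_all
    ultimately show "0 < h m * x ^ m / qpoch a q m"
      using qpoch_pos[OF q a] by simp
  qed
qed

text \<open>Since \<open>F c m\<close> is \<open>q_series q h (c * q ^ m) x / qpoch c q m\<close>,
  the claim reads \<open>F a 0 / F b 0 < F a m / F b m\<close>, which follows by chaining unit steps
  in \<open>m\<close>.\<close>

lemma q_series_lower:
  assumes q: "0 < q" "q < 1" and b: "0 < b" "b < a" "a < 1" and h: "doubly_positive h"
    and x: "0 \<le> x" "x \<noteq> 0 \<or> h 0 \<noteq> 0" "ereal x < conv_radius h" and m: "0 < m"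
  shows "qpoch a q m / qpoch b q m * (q_series q h a x * q_series q h (b * q ^ m) x)
    < q_series q h (a * q ^ m) x * q_series q h b x"
proof -
  define F where "F c m = (\<Sum>n. h n * x ^ n * (1 / qpoch c q (n + m)))" for c m
  have cm: "0 < c * q ^ m" "c * q ^ m < 1" if "0 < c" "c < 1" for c m
    using qpoch_factor_pos[OF q that, of m] q that by auto
  have tm: "h n * x ^ n * (1 / qpoch c q (n + m))
      = 1 / qpoch c q m * (h n * x ^ n / qpoch (c * q ^ m) q n)" for c n m
    by (subst add.commute) (simp add: qpoch_add)
  have S: "summable (\<lambda>n. norm (h n * x ^ n * (1 / qpoch c q (n + m))))" if "0 < c" "c < 1" for c m
    unfolding tm norm_mult
    by (intro summable_mult q_series_abs_summable[OF q cm[OF that] x(1,3)])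
  have F: "F c m = q_series q h (c * q ^ m) x / qpoch c q m" if "0 < c" "c < 1" for c m
    unfolding F_def tm q_series_def
    by (subst suminf_mult[OF summable_norm_cancel[OF q_series_abs_summable[OF q cm[OF that] x(1,3)]]]) simp
  have ab: "0 < a" "a < 1" "0 < b" "b < 1" using b by auto
  have pa: "0 < qpoch a q n" and pb: "0 < qpoch b q n" for n
    using qpoch_pos[OF q] ab by auto
  \<comment> \<open>Each new factor \<open>(1 - a * q ^ n) / (1 - b * q ^ n)\<close> is below 1
    because \<open>b < a\<close>, so the quotient of the reciprocals increases.\<close>
  have ratio: "1 / qpoch a q i * (1 / qpoch b q j) < 1 / qpoch a q j * (1 / qpoch b q i)" if "i < j" for i j
  proof -
    have step: "qpoch a q (Suc n) / qpoch b q (Suc n) < qpoch a q n / qpoch b q n" for n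
    proof -
      have f: "0 < 1 - b * q ^ n" "1 - a * q ^ n < 1 - b * q ^ n"
        using qpoch_factor_pos[OF q ab(3,4)] b q by auto
      have "qpoch a q (Suc n) / qpoch b q (Suc n)
          = qpoch a q n / qpoch b q n * ((1 - a * q ^ n) / (1 - b * q ^ n))"
        by (simp add: qpoch_Suc)
      also have "\<dots> < qpoch a q n / qpoch b q n * 1"
        using f pa pb by (intro mult_strict_left_mono) auto
      finally show ?thesis by simp
    qed
    have "qpoch a q j / qpoch b q j < qpoch a q i / qpoch b q i"
      using lift_Suc_mono_less[of "\<lambda>n. - (qpoch a q n / qpoch b q n)", OF _ that] step by simp
    thus ?thesis using pa pb by (simp add: field_simps)
  qed
  have Fpos: "0 < F a n" "0 < F b n" for n
    using F q_series_pos[OF q cm h x] ab pa pb by auto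
  have step: "F a n / F b n < F a (Suc n) / F b (Suc n)" for n
  proof -
    have "F a n * F b (Suc n) < F a (Suc n) * F b n"
      using shifted_series_ratio_less[OF h x(1,2),
          of "\<lambda>k. 1 / qpoch a q (k + n)" "\<lambda>k. 1 / qpoch b q (k + n)"]
        ratio S[OF ab(1,2)] S[OF ab(3,4)] S[of a "Suc n"] S[of b "Suc n"] ab
      by (simp add: F_def)
    thus ?thesis using Fpos by (simp add: field_simps)
  qed
  have "F a 0 / F b 0 < F a m / F b m"
    using lift_Suc_mono_less[of "\<lambda>n. F a n / F b n", OF step m] .
  hence "F a 0 * F b m < F a m * F b 0" using Fpos by (simp add: field_simps)
  thus ?thesis using pa[of m] pb[of m] ab by (simp add: F field_simps)
qed

section \<open>The two-sided estimates and their cases of equality\<close>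

text \<open>If \<open>x = 0\<close> and \<open>h 0 = 0\<close>, then \<open>N\<close> and
  \<open>D\<close> vanish and the strict bounds fail, hence the guard
  \<open>x \<noteq> 0 \<or> h 0 \<noteq> 0\<close>. Sequences supported at index 0 also attain the
  upper bounds. The last factor in the numerator of \<open>U\<close> is justified by
  \<open>q_Delta_upper_factor_needed\<close>.\<close>

theorem corollary4p2:
  fixes q :: real and h :: "nat \<Rightarrow> real"
  assumes q: "0 < q" "q < 1"
  shows
    "(doubly_positive h \<longrightarrow>
       (\<forall>\<mu> \<beta> x :: real. \<forall>\<alpha> :: nat.
          0 < \<mu> \<and> 0 < \<beta> \<and> 1 \<le> \<alpha> \<and> 0 \<le> x \<and> ereal x < q_radius q h (q powr \<mu>) \<longrightarrow>
          (let G = q_Gamma q (\<mu> + real \<alpha>) * q_Gamma q (\<mu> + \<beta>) /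
                   (q_Gamma q \<mu> * q_Gamma q (\<mu> + real \<alpha> + \<beta>));
               N = q_series q h (q powr (\<mu> + real \<alpha>)) x * q_series q h (q powr (\<mu> + \<beta>)) x;
               D = q_series q h (q powr \<mu>) x * q_series q h (q powr (\<mu> + real \<alpha> + \<beta>)) x;
               U = - (h 0 * h 1 * x * q powr \<mu> * (1 - q powr (real \<alpha>)) * (1 - q powr \<beta>)
                      * (1 - q powr (2 * \<mu> + real \<alpha> + \<beta>)))
                   / ((1 - q powr \<mu>) * (1 - q powr (\<mu> + real \<alpha> + \<beta>))
                      * (1 - q powr (\<mu> + real \<alpha>)) * (1 - q powr (\<mu> + \<beta>)))
           in (x \<noteq> 0 \<or> h 0 \<noteq> 0 \<longrightarrow>
                 D \<noteq> 0 \<and>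
                 G < N / D \<and>
                 (G - 1) * D < q_Delta q h \<mu> (real \<alpha>) \<beta> x \<and>
                 (N / D = 1 \<longleftrightarrow> x = 0 \<or> (\<forall>n\<ge>1. h n = 0))) \<and>
              N / D \<le> 1 \<and>
              q_Delta q h \<mu> (real \<alpha>) \<beta> x \<le> U \<and>
              (q_Delta q h \<mu> (real \<alpha>) \<beta> x = U \<longleftrightarrow> x = 0 \<or> (\<forall>n\<ge>1. h n = 0))))) \<and>
     ((\<forall>n. 0 \<le> h n) \<longrightarrow>
       (\<forall>\<mu> \<alpha> \<beta> x :: real.
          0 < \<mu> \<and> 0 < \<alpha> \<and> 0 < \<beta> \<and> 0 \<le> x \<and> ereal x < q_radius q h (q powr \<mu>) \<longrightarrow>
          (let N = q_series q h (q powr (\<mu> + \<alpha>)) x * q_series q h (q powr (\<mu> + \<beta>)) x;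
               D = q_series q h (q powr \<mu>) x * q_series q h (q powr (\<mu> + \<alpha> + \<beta>)) x;
               U = - (h 0 * h 1 * x * q powr \<mu> * (1 - q powr \<alpha>) * (1 - q powr \<beta>)
                      * (1 - q powr (2 * \<mu> + \<alpha> + \<beta>)))
                   / ((1 - q powr \<mu>) * (1 - q powr (\<mu> + \<alpha> + \<beta>))
                      * (1 - q powr (\<mu> + \<alpha>)) * (1 - q powr (\<mu> + \<beta>)))
           in N / D \<le> 1 \<and> q_Delta q h \<mu> \<alpha> \<beta> x \<le> U)))"
proof -
  \<comment> \<open>\<open>D = 0\<close> is allowed, since the quotient is then 0.\<close>
  have upper: "N / D \<le> 1"
    if "N - D \<le> 0" "0 \<le> D" for N D :: real
    using that by (auto simp: divide_le_eq_1)
  have nonneg: "0 \<le> q_series q h (q powr z) x"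
    if "\<forall>n. 0 \<le> h n" "0 < z" "0 \<le> x" "ereal x < conv_radius h" for z x
  proof -
    have z: "0 < q powr z" "q powr z < 1" using q that by (auto intro: q_powr_less_1)
    show ?thesis unfolding q_series_def
    proof (rule suminf_nonneg)
      show "summable (\<lambda>n. h n * x ^ n / qpoch (q powr z) q n)"
        by (rule summable_norm_cancel[OF q_series_abs_summable[OF q z that(3,4)]])
      show "0 \<le> h n * x ^ n / qpoch (q powr z) q n" for n
        using that qpoch_pos[OF q z, of n] by simp
    qed
  qed
  have R: "q_radius q h (q powr \<mu>) = conv_radius h" if "0 < \<mu>" for \<mu>
    using q that by (intro q_radius_indep q_powr_less_1) auto
  \<comment> \<open>The quotient bound follows from \<open>q_Delta \<le> U \<le> 0\<close>.\<close>
  have ratio: "q_series q h (q powr (\<mu> + \<alpha>)) x * q_series q h (q powr (\<mu> + \<beta>)) x /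
      (q_series q h (q powr \<mu>) x * q_series q h (q powr (\<mu> + \<alpha> + \<beta>)) x) \<le> 1"
    if "\<forall>n. 0 \<le> h n" "0 < \<mu>" "0 < \<alpha>" "0 < \<beta>" "0 \<le> x" "ereal x < conv_radius h" for \<mu> \<alpha> \<beta> x
  proof (rule upper)
    show "q_series q h (q powr (\<mu> + \<alpha>)) x * q_series q h (q powr (\<mu> + \<beta>)) x -
        q_series q h (q powr \<mu>) x * q_series q h (q powr (\<mu> + \<alpha> + \<beta>)) x \<le> 0"
      using q_Delta_upper(1,2)[OF q that(2-6) that(1)[rule_format]] unfolding q_Delta_def
      by (rule order_trans[rotated])
    show "0 \<le> q_series q h (q powr \<mu>) x * q_series q h (q powr (\<mu> + \<alpha> + \<beta>)) x"
      using that by (intro mult_nonneg_nonneg nonneg) auto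
  qed
  have strict: "D \<noteq> 0 \<and> q_Gamma q (\<mu> + real \<alpha>) * q_Gamma q (\<mu> + \<beta>) /
        (q_Gamma q \<mu> * q_Gamma q (\<mu> + real \<alpha> + \<beta>)) < N / D \<and>
      (q_Gamma q (\<mu> + real \<alpha>) * q_Gamma q (\<mu> + \<beta>) /
        (q_Gamma q \<mu> * q_Gamma q (\<mu> + real \<alpha> + \<beta>)) - 1) * D < q_Delta q h \<mu> (real \<alpha>) \<beta> x \<and>
      (N / D = 1 \<longleftrightarrow> x = 0 \<or> (\<forall>n\<ge>1. h n = 0))"
    if h: "doubly_positive h" and pos: "0 < \<mu>" "0 < \<beta>" "1 \<le> \<alpha>"
      and x: "0 \<le> x" "x \<noteq> 0 \<or> h 0 \<noteq> 0" "ereal x < conv_radius h"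
      and N: "N = q_series q h (q powr (\<mu> + real \<alpha>)) x * q_series q h (q powr (\<mu> + \<beta>)) x"
      and D: "D = q_series q h (q powr \<mu>) x * q_series q h (q powr (\<mu> + real \<alpha> + \<beta>)) x"
    for \<mu> \<beta> x N D and \<alpha> :: nat
  proof -
    have nn: "\<And>n. 0 \<le> h n" using h by (simp add: doubly_positive_def)
    have \<alpha>: "0 < real \<alpha>" using pos by simp
    define G where "G = q_Gamma q (\<mu> + real \<alpha>) * q_Gamma q (\<mu> + \<beta>) /
        (q_Gamma q \<mu> * q_Gamma q (\<mu> + real \<alpha> + \<beta>))"
    have Dpos: "0 < D" unfolding D
      using q pos by (intro mult_pos_pos q_series_pos h x q_powr_less_1) auto
    have ab: "0 < q powr (\<mu> + \<beta>)" "q powr (\<mu> + \<beta>) < q powr \<mu>" "q powr \<mu> < 1"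
      using q pos by (auto intro: q_powr_less_1 simp: powr_less_cancel_iff powr_less_mono')
    have e: "q powr \<mu> * q ^ \<alpha> = q powr (\<mu> + real \<alpha>)"
      "q powr (\<mu> + \<beta>) * q ^ \<alpha> = q powr (\<mu> + real \<alpha> + \<beta>)"
      using q by (simp_all add: powr_add powr_realpow)
    \<comment> \<open>Both lower bounds are this inequality: divide by \<open>D > 0\<close> for the
      quotient, subtract \<open>D\<close> for the difference.\<close>
    have GD: "G * D < N"
      using q_series_lower[OF q ab h x, of \<alpha>] pos
      unfolding G_def q_Gamma_quotient[OF q pos(1,2)] e N D by simp
    have Delta: "q_Delta q h \<mu> (real \<alpha>) \<beta> x = N - D" by (simp add: q_Delta_def N D)
    have "N = D \<longleftrightarrow> x = 0 \<or> (\<forall>n\<ge>1. h n = 0)"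
      using q_Delta_upper(4)[OF q pos(1) \<alpha> pos(2) x(1,3) nn] unfolding Delta by simp
    thus ?thesis
      using Dpos GD unfolding G_def[symmetric] Delta
      by (auto simp: pos_less_divide_eq left_diff_distrib)
  qed
  show ?thesis
  proof (intro conjI impI allI)
    fix \<mu> \<beta> x :: real and \<alpha> :: nat
    assume h: "doubly_positive h"
      and as: "0 < \<mu> \<and> 0 < \<beta> \<and> 1 \<le> \<alpha> \<and> 0 \<le> x \<and> ereal x < q_radius q h (q powr \<mu>)"
    hence nn: "\<And>n. 0 \<le> h n" and p: "0 < \<mu>" "0 < real \<alpha>" "0 < \<beta>" "0 \<le> x" "ereal x < conv_radius h"
      by (auto simp: doubly_positive_def R)
    show "let G = q_Gamma q (\<mu> + real \<alpha>) * q_Gamma q (\<mu> + \<beta>) /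
                   (q_Gamma q \<mu> * q_Gamma q (\<mu> + real \<alpha> + \<beta>));
               N = q_series q h (q powr (\<mu> + real \<alpha>)) x * q_series q h (q powr (\<mu> + \<beta>)) x;
               D = q_series q h (q powr \<mu>) x * q_series q h (q powr (\<mu> + real \<alpha> + \<beta>)) x;
               U = - (h 0 * h 1 * x * q powr \<mu> * (1 - q powr (real \<alpha>)) * (1 - q powr \<beta>)
                      * (1 - q powr (2 * \<mu> + real \<alpha> + \<beta>)))
                   / ((1 - q powr \<mu>) * (1 - q powr (\<mu> + real \<alpha> + \<beta>))
                      * (1 - q powr (\<mu> + real \<alpha>)) * (1 - q powr (\<mu> + \<beta>)))
           in (x \<noteq> 0 \<or> h 0 \<noteq> 0 \<longrightarrow>
                 D \<noteq> 0 \<and>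
                 G < N / D \<and>
                 (G - 1) * D < q_Delta q h \<mu> (real \<alpha>) \<beta> x \<and>
                 (N / D = 1 \<longleftrightarrow> x = 0 \<or> (\<forall>n\<ge>1. h n = 0))) \<and>
              N / D \<le> 1 \<and>
              q_Delta q h \<mu> (real \<alpha>) \<beta> x \<le> U \<and>
              (q_Delta q h \<mu> (real \<alpha>) \<beta> x = U \<longleftrightarrow> x = 0 \<or> (\<forall>n\<ge>1. h n = 0))"
      unfolding Let_def
      by (intro conjI[OF impI] conjI strict[OF h] ratio q_Delta_upper(2,3)[OF q p nn])
        (use as p nn in auto)
  next
    fix \<mu> \<alpha> \<beta> x :: real
    assume h: "\<forall>n. 0 \<le> h n"
      and as: "0 < \<mu> \<and> 0 < \<alpha> \<and> 0 < \<beta> \<and> 0 \<le> x \<and> ereal x < q_radius q h (q powr \<mu>)"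
    hence p: "0 < \<mu>" "0 < \<alpha>" "0 < \<beta>" "0 \<le> x" "ereal x < conv_radius h"
      by (auto simp: R)
    show "let N = q_series q h (q powr (\<mu> + \<alpha>)) x * q_series q h (q powr (\<mu> + \<beta>)) x;
               D = q_series q h (q powr \<mu>) x * q_series q h (q powr (\<mu> + \<alpha> + \<beta>)) x;
               U = - (h 0 * h 1 * x * q powr \<mu> * (1 - q powr \<alpha>) * (1 - q powr \<beta>)
                      * (1 - q powr (2 * \<mu> + \<alpha> + \<beta>)))
                   / ((1 - q powr \<mu>) * (1 - q powr (\<mu> + \<alpha> + \<beta>))
                      * (1 - q powr (\<mu> + \<alpha>)) * (1 - q powr (\<mu> + \<beta>)))
           in N / D \<le> 1 \<and> q_Delta q h \<mu> \<alpha> \<beta> x \<le> U"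
      unfolding Let_def
      using ratio[OF h p] q_Delta_upper(2)[OF q p h[rule_format]] by (rule conjI)
  qed
qed

end
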